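(* Let $X$ be a doubling metric space with $\dim_L(X)\le n$, and let $(Z,z)$ be a weak tangent of $X$. Then $\dim_L(Z)\le n$.
   Context: Doubling: a metric space is doubling if there is $N$ such that every ball can be covered by $N$ balls of half the radius. Lipschitz dimension: for $r>0$, an $r$-path in a metric space $X$ is a finite sequence $(x_1,\dots,x_k)$ in $X$ with $d(x_i,x_{i+1})\le r$ for $1\le i\le k-1$. Two points are in the same $r$-component of $X$ if some $r$-path in $X$ contains both. The $r$-components of a subset are those of the subset as a metric space. A map $f\colon X\to Y$ is Lipschitz light if there is $C>0$ such that $f$ is $C$-Lipschitz and, for every $r>0$ and every $W\subset Y$ with $\mathrm{diam}(W)\le r$, the $r$-components of $f^{-1}(W)$ have diameter at most $Cr$. One writes $\dim_L(X)\le n$ if there is a Lipschitz light map $X\to\mathbb{R}^n$ (with $\mathbb{R}^0$ a one-point space); $\dim_L(X)$ is the minimal such integer $n\ge0$, or $\infty$ if there is none. Convergence of sets: non-empty closed sets $F_j\subseteq\mathbb{R}^N$ converge to a non-empty closed set $F\subseteq\mathbb{R}^N$ if for all $R>0$, $\lim_{j}\sup_{x\in F_j\cap B(0,R)}\mathrm{dist}(x,F)=0$ and $\lim_j\sup_{y\in F\cap B(0,R)}\mathrm{dist}(y,F_j)=0$. Convergence of maps: if $F_j\to F$ in this sense and $f_j\colon F_j\to Y$, $f\colon F\to Y$ are maps into a metric space $Y$, then $f_j$ converges to $f$ if $f_j(x_j)\to f(x)$ whenever $x_j\in F_j$ and $x_j\to x\in F$. Convergence of pointed spaces: $(X_j,d_j,p_j)$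 converges to $(X,d,p)$ if there exist $\alpha\in(0,1]$, $N\in\mathbb{N}$, $L\ge 1$ and $L$-bi-Lipschitz embeddings $e_j\colon(X_j,d_j^\alpha)\to\mathbb{R}^N$, $e\colon(X,d^\alpha)\to\mathbb{R}^N$ with $e_j(p_j)=e(p)=0$, such that $e_j(X_j)$ converges to $e(X)$ as non-empty closed subsets of $\mathbb{R}^N$, i.e. for all $R>0$, $\lim_j\sup_{x\in e_j(X_j)\cap B(0,R)}\mathrm{dist}(x,e(X))=0$ and $\lim_j\sup_{y\in e(X)\cap B(0,R)}\mathrm{dist}(y,e_j(X_j))=0$ (in particular these images are closed) and the functions $(x,y)\mapsto d_j(e_j^{-1}(x),e_j^{-1}(y))$ on $e_j(X_j)\times e_j(X_j)$ converge to $(x,y)\mapsto d(e^{-1}(x),e^{-1}(y))$ on $e(X)\times e(X)$. Weak tangent: a weak tangent of $(X,d)$ is any limit, in this sense, of pointed metric spaces of the form $(X,\lambda_kd,x_k)$ with $\lambda_k>0$ and $x_k\in X$. *)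

theory Defs
  imports "HOL-Analysis.Analysis"
begin

text \<open>Metric spaces are carrier-based throughout (locale \<^locale>\<open>Metric_space\<close>), because the
  dimension of the target \<open>\<real>\<^sup>N\<close> is quantified and the metrics get rescaled.\<close>

section \<open>Euclidean spaces\<close>

text \<open>\<open>\<real>\<^sup>N\<close> is the set of sequences vanishing from index \<open>N\<close> on; \<open>\<real>\<^sup>0\<close> is one point.\<close>

definition Rn :: "nat \<Rightarrow> (nat \<Rightarrow> real) set" where
  "Rn N = topspace (Euclidean_space N)"

definition Rn_dist :: "nat \<Rightarrow> (nat \<Rightarrow> real) \<Rightarrow> (nat \<Rightarrow> real) \<Rightarrow> real" where
  "Rn_dist N x y = L2_set (\<lambda>i. x i - y i) {..<N}"

lemma Metric_space_Rn: "Metric_space (Rn N) (Rn_dist N)"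
proof
  show "0 \<le> Rn_dist N x y" for x y
    by (simp add: Rn_dist_def)
  show "Rn_dist N x y = Rn_dist N y x" for x y
    by (simp add: Rn_dist_def L2_set_def power2_commute)
  show "Rn_dist N x y = 0 \<longleftrightarrow> x = y" if "x \<in> Rn N" "y \<in> Rn N" for x y
  proof -
    have "x = y" if "\<forall>i<N. x i = y i"
    proof
      fix i show "x i = y i"
        using that \<open>x \<in> Rn N\<close> \<open>y \<in> Rn N\<close>
        by (cases "i < N") (auto simp: Rn_def topspace_Euclidean_space)
    qed
    then show ?thesis
      by (auto simp: Rn_dist_def L2_set_eq_0_iff)
  qed
  show "Rn_dist N x z \<le> Rn_dist N x y + Rn_dist N y z" for x y z
    using L2_set_triangle_ineq [of "\<lambda>i. x i - y i" "\<lambda>i. y i - z i" "{..<N}"]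
    by (simp add: Rn_dist_def)
qed

abbreviation Rn_topology :: "nat \<Rightarrow> (nat \<Rightarrow> real) topology" where
  "Rn_topology N \<equiv> Metric_space.mtopology (Rn N) (Rn_dist N)"

abbreviation Rn_ball :: "nat \<Rightarrow> (nat \<Rightarrow> real) \<Rightarrow> real \<Rightarrow> (nat \<Rightarrow> real) set" where
  "Rn_ball N \<equiv> Metric_space.mball (Rn N) (Rn_dist N)"

section \<open>Doubling spaces\<close>

definition doubling :: "'a set \<Rightarrow> ('a \<Rightarrow> 'a \<Rightarrow> real) \<Rightarrow> bool" where
  "doubling X d \<longleftrightarrow>
     (\<exists>N::nat. \<forall>x\<in>X. \<forall>r>0. \<exists>A\<subseteq>X. finite A \<and> card A \<le> N \<and>
        Metric_space.mball X d x r \<subseteq> (\<Union>a\<in>A. Metric_space.mball X d a (r / 2)))"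

section \<open>Lipschitz dimension\<close>

definition r_path :: "'a set \<Rightarrow> ('a \<Rightarrow> 'a \<Rightarrow> real) \<Rightarrow> real \<Rightarrow> 'a list \<Rightarrow> bool" where
  "r_path X d r xs \<longleftrightarrow> set xs \<subseteq> X \<and> successively (\<lambda>x y. d x y \<le> r) xs"

definition r_components :: "'a set \<Rightarrow> ('a \<Rightarrow> 'a \<Rightarrow> real) \<Rightarrow> real \<Rightarrow> 'a set set" where
  "r_components X d r = X // {(x, y). \<exists>xs. r_path X d r xs \<and> x \<in> set xs \<and> y \<in> set xs}"

text \<open>Suprema are taken in \<^typ>\<open>ennreal\<close>, so that unbounded sets have infinite diameter and
  the supremum over the empty set is \<open>0\<close>.\<close>

definition ediam :: "('a \<Rightarrow> 'a \<Rightarrow> real) \<Rightarrow> 'a set \<Rightarrow> ennreal" where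
  "ediam d S = (SUP x\<in>S. SUP y\<in>S. ennreal (d x y))"

definition Lipschitz_light ::
  "'a set \<Rightarrow> ('a \<Rightarrow> 'a \<Rightarrow> real) \<Rightarrow> 'b set \<Rightarrow> ('b \<Rightarrow> 'b \<Rightarrow> real) \<Rightarrow> ('a \<Rightarrow> 'b) \<Rightarrow> bool" where
  "Lipschitz_light X dX Y dY f \<longleftrightarrow>
     f \<in> X \<rightarrow> Y \<and>
     (\<exists>C>0. (\<forall>x\<in>X. \<forall>y\<in>X. dY (f x) (f y) \<le> C * dX x y) \<and>
        (\<forall>r>0. \<forall>W\<subseteq>Y. ediam dY W \<le> ennreal r \<longrightarrow>
           (\<forall>K \<in> r_components {x\<in>X. f x \<in> W} dX r. ediam dX K \<le> ennreal (C * r))))"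

text \<open>In \<^typ>\<open>enat\<close>, \<^term>\<open>Inf\<close> of a nonempty set is its minimum and \<^term>\<open>Inf {}\<close> is \<open>\<infinity>\<close>.\<close>

definition Lipschitz_dim :: "'a set \<Rightarrow> ('a \<Rightarrow> 'a \<Rightarrow> real) \<Rightarrow> enat" where
  "Lipschitz_dim X d = Inf {enat n |n. \<exists>f. Lipschitz_light X d (Rn n) (Rn_dist n) f}"

section \<open>Convergence of sets, maps and pointed metric spaces\<close>

definition set_dist :: "('a \<Rightarrow> 'a \<Rightarrow> real) \<Rightarrow> 'a \<Rightarrow> 'a set \<Rightarrow> ennreal" where
  "set_dist d x S = (INF y\<in>S. ennreal (d x y))"

definition sets_converge :: "nat \<Rightarrow> (nat \<Rightarrow> (nat \<Rightarrow> real) set) \<Rightarrow> (nat \<Rightarrow> real) set \<Rightarrow> bool" where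
  "sets_converge N F F' \<longleftrightarrow>
     (\<forall>j. F j \<noteq> {} \<and> closedin (Rn_topology N) (F j)) \<and>
     F' \<noteq> {} \<and> closedin (Rn_topology N) F' \<and>
     (\<forall>R>0.
        (\<lambda>j. SUP x \<in> F j \<inter> Rn_ball N (\<lambda>i. 0) R. set_dist (Rn_dist N) x F')
          \<longlonglongrightarrow> 0 \<and>
        (\<lambda>j. SUP y \<in> F' \<inter> Rn_ball N (\<lambda>i. 0) R. set_dist (Rn_dist N) y (F j))
          \<longlonglongrightarrow> 0)"

text \<open>\<open>T\<close> is the ambient topology in which the domains \<open>F j\<close> and \<open>F'\<close> converge.\<close>

definition maps_converge ::
  "'a topology \<Rightarrow> 'b topology \<Rightarrow> (nat \<Rightarrow> 'a set) \<Rightarrow> (nat \<Rightarrow> 'a \<Rightarrow> 'b) \<Rightarrow> 'a set \<Rightarrow> ('a \<Rightarrow> 'b) \<Rightarrow> bool" where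
  "maps_converge T Y F f F' f' \<longleftrightarrow>
     (\<forall>x x'. (\<forall>j. x j \<in> F j) \<and> x' \<in> F' \<and> limitin T x x' sequentially \<longrightarrow>
        limitin Y (\<lambda>j. f j (x j)) (f' x') sequentially)"

definition bi_Lipschitz ::
  "real \<Rightarrow> 'a set \<Rightarrow> ('a \<Rightarrow> 'a \<Rightarrow> real) \<Rightarrow> 'b set \<Rightarrow> ('b \<Rightarrow> 'b \<Rightarrow> real) \<Rightarrow> ('a \<Rightarrow> 'b) \<Rightarrow> bool" where
  "bi_Lipschitz L X dX Y dY f \<longleftrightarrow>
     f \<in> X \<rightarrow> Y \<and>
     (\<forall>x\<in>X. \<forall>y\<in>X. dX x y / L \<le> dY (f x) (f y) \<and> dY (f x) (f y) \<le> L * dX x y)"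

definition pulled_metric ::
  "'a set \<Rightarrow> ('a \<Rightarrow> 'a \<Rightarrow> real) \<Rightarrow> ('a \<Rightarrow> 'b) \<Rightarrow> 'b \<times> 'b \<Rightarrow> real" where
  "pulled_metric X d e = (\<lambda>(x, y). d (inv_into X e x) (inv_into X e y))"

definition pointed_converges ::
  "(nat \<Rightarrow> 'a set) \<Rightarrow> (nat \<Rightarrow> 'a \<Rightarrow> 'a \<Rightarrow> real) \<Rightarrow> (nat \<Rightarrow> 'a) \<Rightarrow>
   'b set \<Rightarrow> ('b \<Rightarrow> 'b \<Rightarrow> real) \<Rightarrow> 'b \<Rightarrow> bool" where
  "pointed_converges X d p Z dZ z \<longleftrightarrow>
     (\<exists>\<alpha> N L e e'. 0 < \<alpha> \<and> \<alpha> \<le> 1 \<and> 1 \<le> L \<and>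
        (\<forall>j. bi_Lipschitz L (X j) (\<lambda>x y. d j x y powr \<alpha>) (Rn N) (Rn_dist N) (e j) \<and>
             e j (p j) = (\<lambda>i. 0)) \<and>
        bi_Lipschitz L Z (\<lambda>x y. dZ x y powr \<alpha>) (Rn N) (Rn_dist N) e' \<and> e' z = (\<lambda>i. 0) \<and>
        sets_converge N (\<lambda>j. e j ` X j) (e' ` Z) \<and>
        maps_converge (prod_topology (Rn_topology N) (Rn_topology N)) euclideanreal
          (\<lambda>j. e j ` X j \<times> e j ` X j) (\<lambda>j. pulled_metric (X j) (d j) (e j))
          (e' ` Z \<times> e' ` Z) (pulled_metric Z dZ e'))"

definition weak_tangent ::
  "'a set \<Rightarrow> ('a \<Rightarrow> 'a \<Rightarrow> real) \<Rightarrow> 'b set \<Rightarrow> ('b \<Rightarrow> 'b \<Rightarrow> real) \<Rightarrow> 'b \<Rightarrow> bool" where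
  "weak_tangent X d Z dZ z \<longleftrightarrow>
     Metric_space Z dZ \<and> z \<in> Z \<and>
     (\<exists>l x. (\<forall>k. l k > 0 \<and> x k \<in> X) \<and>
        pointed_converges (\<lambda>k. X) (\<lambda>k u v. l k * d u v) x Z dZ z)"

end

theory Submission
  imports Defs
begin

text \<open>
  A Lipschitz light map on \<open>X\<close> is rescaled along with the metric and passed to the limit. If
  \<open>f\<close> is Lipschitz light on \<open>(X, d)\<close> with constant \<open>C\<close>, then so is \<open>l \<cdot> (f - a)\<close> on
  \<open>(X, l \<cdot> d)\<close>, with the same constant, for every \<open>l > 0\<close> and every vector \<open>a\<close>. In a
  weak tangent every point \<open>w \<in> Z\<close> is a limit of points \<open>\<sigma> k w \<in> X\<close>, and the rescaled
  distances \<open>l k \<cdot> d (\<sigma> k u) (\<sigma> k v)\<close> converge to \<open>dZ u v\<close>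
  (\<open>weak_tangent_lifts\<close>). This reduces the theorem to a statement about such lifts.

  The maps \<open>\<phi> k w = l k \<cdot> (f (\<sigma> k w) - f (\<sigma> k z))\<close> from \<open>Z\<close> to \<open>\<real>\<^sup>m\<close> are bounded at each
  \<open>w\<close>, so by Tychonoff's theorem they have a cluster point \<open>g\<close> in the product topology
  (\<open>Rn_cluster_map\<close>): on any finite subset of \<open>Z\<close>, \<open>g\<close> is approximated arbitrarily
  well by some \<open>\<phi> k\<close> with \<open>k\<close> as large as desired.

  Approximation on finite sets is enough, because both parts of Lipschitz lightness concern
  finitely many points at a time: the Lipschitz bound concerns two points, and the bound on
  components concerns the points of one finite chain. A chain in \<open>Z\<close> with steps at most \<open>r\<close>,
  whose image under \<open>g\<close> has diameter at most \<open>r\<close>, lifts to a chain in \<open>X\<close> with rescaled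
  steps and rescaled image diameter at most \<open>r + 2\<epsilon>\<close>. Lightness of \<open>f\<close> bounds the rescaled
  distance of any two of its points by \<open>C \<cdot> (r + 2\<epsilon>)\<close>, and \<open>\<epsilon> \<rightarrow> 0\<close> gives the bound
  \<open>C \<cdot> r\<close> in \<open>Z\<close> (\<open>Lipschitz_light_limit\<close>).
\<close>

section \<open>Components and chains\<close>

lemma dist_le_of_ediam_le:
  assumes "ediam d S \<le> ennreal D" "x \<in> S" "y \<in> S" "0 \<le> D"
  shows "d x y \<le> D"
proof -
  have "ennreal (d x y) \<le> (SUP y\<in>S. ennreal (d x y))"
    using \<open>y \<in> S\<close> by (rule SUP_upper)
  also have "\<dots> \<le> ediam d S"
    unfolding ediam_def using \<open>x \<in> S\<close> by (rule SUP_upper)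
  also note assms(1)
  finally show ?thesis
    using \<open>0 \<le> D\<close> by (simp add: ennreal_le_iff)
qed

text \<open>Together with the next lemma this translates bounds on components into bounds on chains,
  which are the finite objects that can be transported between \<open>Z\<close> and \<open>X\<close>.\<close>

lemma r_path_dist_le:
  assumes "\<forall>K \<in> r_components X d r. ediam d K \<le> ennreal D"
    and xs: "r_path X d r xs" "x \<in> set xs" "y \<in> set xs"
    and "0 \<le> D"
  shows "d x y \<le> D"
proof -
  let ?E = "{(x, y). \<exists>xs. r_path X d r xs \<and> x \<in> set xs \<and> y \<in> set xs}"
  have "x \<in> X"
    using xs by (auto simp: r_path_def)
  then have "?E `` {x} \<in> r_components X d r"
    unfolding r_components_def by (rule quotientI)
  with assms(1) have "ediam d (?E `` {x}) \<le> ennreal D"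
    by (rule bspec)
  moreover have "x \<in> ?E `` {x}" "y \<in> ?E `` {x}"
    using xs by auto
  ultimately show ?thesis
    using \<open>0 \<le> D\<close> by (rule dist_le_of_ediam_le)
qed

text \<open>Two points of a component are joined to its base point by one chain each. Passing through
  the base point costs a factor 2 but avoids concatenating the two chains.\<close>

lemma r_component_ediam_le:
  assumes "Metric_space X d" "S \<subseteq> X" "K \<in> r_components S d r"
    and D: "\<And>xs x y. \<lbrakk>r_path S d r xs; x \<in> set xs; y \<in> set xs\<rbrakk> \<Longrightarrow> d x y \<le> D"
  shows "ediam d K \<le> ennreal (2 * D)"
proof -
  interpret Metric_space X d by fact
  obtain x where K: "K = {y. \<exists>xs. r_path S d r xs \<and> x \<in> set xs \<and> y \<in> set xs}"
    using assms(3) unfolding r_components_def by (auto elim!: quotientE)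
  have "d u v \<le> 2 * D" if uv: "u \<in> K" "v \<in> K" for u v
  proof -
    obtain xs ys where "r_path S d r xs" "x \<in> set xs" "u \<in> set xs"
      "r_path S d r ys" "x \<in> set ys" "v \<in> set ys"
      using uv unfolding K by blast
    then have "d u x \<le> D" "d x v \<le> D" "x \<in> X" "u \<in> X" "v \<in> X"
      using D \<open>S \<subseteq> X\<close> by (auto simp: r_path_def)
    then show ?thesis
      using triangle [of u x v] by linarith
  qed
  then show ?thesis
    unfolding ediam_def by (intro SUP_least ennreal_leI)
qed

section \<open>Cluster points of pointwise bounded sequences\<close>

text \<open>The sequence lives in a product of compact intervals, which is compact, so the filter it
  generates has a cluster point; the conclusion spells out basic neighbourhoods of it. The
  index set may be uncountable, so a convergent subsequence need not exist; the indices
  \<open>k\<close> therefore depend on \<open>S\<close> and \<open>e\<close>.\<close>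

lemma pointwise_bounded_cluster_point:
  fixes \<phi> :: "nat \<Rightarrow> 'i \<Rightarrow> real"
  assumes "\<And>p. \<exists>B. \<forall>k. \<bar>\<phi> k p\<bar> \<le> B"
  obtains g where
    "\<And>S e. \<lbrakk>finite S; 0 < e\<rbrakk> \<Longrightarrow> \<exists>\<^sub>F k in sequentially. \<forall>p\<in>S. \<bar>\<phi> k p - g p\<bar> < e"
proof -
  obtain B where B: "\<And>p k. \<bar>\<phi> k p\<bar> \<le> B p"
    using assms by metis
  let ?box = "PiE UNIV (\<lambda>p. {- B p..B p})"
  have "compactin (product_topology (\<lambda>_. euclideanreal) UNIV) ?box"
    by (auto simp: compactin_PiE)
  then have "compact ?box"
    by (simp add: euclidean_product_topology)
  moreover have "filtermap \<phi> sequentially \<le> principal ?box"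
    using B by (auto simp: le_principal eventually_filtermap abs_le_iff intro!: always_eventually)
      (metis minus_le_iff)
  moreover have "filtermap \<phi> sequentially \<noteq> bot"
    by (simp add: filtermap_bot_iff)
  ultimately obtain g where g: "inf (nhds g) (filtermap \<phi> sequentially) \<noteq> bot"
    unfolding compact_filter le_principal by blast
  show thesis
  proof
    fix S :: "'i set" and e :: real assume "finite S" "0 < e"
    \<comment> \<open>Finiteness of \<open>S\<close> is what makes this neighbourhood open in the product topology.\<close>
    let ?U = "\<Inter>p\<in>S. {h::'i \<Rightarrow> real. \<bar>h p - g p\<bar> < e}"
    have "open ?U"
      using \<open>finite S\<close>
      by (intro open_INT open_Collect_less continuous_intros ballI) auto
    moreover have "g \<in> ?U"
      using \<open>0 < e\<close> by simp
    ultimately have "eventually (\<lambda>h. h \<in> ?U) (nhds g)"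
      by (rule eventually_nhds_in_open)
    then have *: "eventually (\<lambda>h. h \<in> ?U) (inf (nhds g) (filtermap \<phi> sequentially))"
      by (rule filter_leD [OF inf_le1])
    have "\<exists>\<^sub>F k in sequentially. \<phi> k \<in> ?U"
    proof (rule ccontr)
      assume "\<not> (\<exists>\<^sub>F k in sequentially. \<phi> k \<in> ?U)"
      then have "eventually (\<lambda>h. h \<notin> ?U) (filtermap \<phi> sequentially)"
        unfolding not_frequently eventually_filtermap .
      then have "eventually (\<lambda>h. h \<notin> ?U) (inf (nhds g) (filtermap \<phi> sequentially))"
        by (rule filter_leD [OF inf_le2])
      with * have "eventually (\<lambda>h. False) (inf (nhds g) (filtermap \<phi> sequentially))"
        by (rule eventually_elim2) blast
      with g show False
        by (simp add: trivial_limit_def)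
    qed
    then show "\<exists>\<^sub>F k in sequentially. \<forall>p\<in>S. \<bar>\<phi> k p - g p\<bar> < e"
      by (rule frequently_elim1) auto
  qed
qed

text \<open>The scalar lemma is applied to all coordinates of all values at once, that is, to functions
  on pairs \<open>(w, i)\<close>.\<close>

lemma Rn_cluster_map:
  fixes \<phi> :: "nat \<Rightarrow> 'b \<Rightarrow> nat \<Rightarrow> real"
  assumes "\<And>w. w \<in> Z \<Longrightarrow> \<exists>B. \<forall>k. \<forall>i<m. \<bar>\<phi> k w i\<bar> \<le> B"
  obtains g where "\<And>w. g w \<in> Rn m"
    "\<And>S e. \<lbrakk>finite S; S \<subseteq> Z; 0 < e\<rbrakk> \<Longrightarrow>
       \<exists>\<^sub>F k in sequentially. \<forall>w\<in>S. Rn_dist m (\<phi> k w) (g w) < e"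
proof -
  define \<psi> where "\<psi> k p = (if fst p \<in> Z \<and> snd p < m then \<phi> k (fst p) (snd p) else 0)" for k p
  have bdd: "\<exists>B. \<forall>k. \<bar>\<psi> k p\<bar> \<le> B" for p
  proof (cases "fst p \<in> Z \<and> snd p < m")
    case True
    then show ?thesis using assms [of "fst p"] by (auto simp: \<psi>_def)
  qed (auto simp: \<psi>_def)
  obtain G where G: "\<And>S e. \<lbrakk>finite S; 0 < e\<rbrakk> \<Longrightarrow>
      \<exists>\<^sub>F k in sequentially. \<forall>p\<in>S. \<bar>\<psi> k p - G p\<bar> < e"
    using pointwise_bounded_cluster_point [of \<psi>, OF bdd] by blast
  show thesis
  proof
    show "(\<lambda>i. if i < m then G (w, i) else 0) \<in> Rn m" for w
      by (auto simp: Rn_def topspace_Euclidean_space)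
    fix S :: "'b set" and e :: real assume S: "finite S" "S \<subseteq> Z" and "0 < e"
    \<comment> \<open>The distance is at most the sum of \<open>m\<close> coordinate errors; the \<open>+ 1\<close> keeps the
      bound positive and strict, also for \<open>m = 0\<close>.\<close>
    let ?e = "e / (real m + 1)"
    have *: "Rn_dist m (\<phi> k w) (\<lambda>i. if i < m then G (w, i) else 0) < e"
      if close: "\<forall>p\<in>S \<times> {..<m}. \<bar>\<psi> k p - G p\<bar> < ?e" and "w \<in> S" for k w
    proof -
      have "Rn_dist m (\<phi> k w) (\<lambda>i. if i < m then G (w, i) else 0)
          \<le> (\<Sum>i<m. \<bar>\<phi> k w i - (if i < m then G (w, i) else 0)\<bar>)"
        unfolding Rn_dist_def by (rule L2_set_le_sum_abs)
      also have "\<dots> \<le> (\<Sum>i<m. ?e)"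
      proof (rule sum_mono)
        fix i assume "i \<in> {..<m}"
        then show "\<bar>\<phi> k w i - (if i < m then G (w, i) else 0)\<bar> \<le> ?e"
          using bspec [OF close, of "(w, i)"] \<open>w \<in> S\<close> S by (auto simp: \<psi>_def)
      qed
      also have "\<dots> < e"
        using \<open>0 < e\<close> by (simp add: field_simps)
      finally show ?thesis .
    qed
    have "\<exists>\<^sub>F k in sequentially. \<forall>p\<in>S \<times> {..<m}. \<bar>\<psi> k p - G p\<bar> < ?e"
      using S \<open>0 < e\<close> by (intro G) auto
    then show "\<exists>\<^sub>F k in sequentially.
        \<forall>w\<in>S. Rn_dist m (\<phi> k w) (\<lambda>i. if i < m then G (w, i) else 0) < e"
      by (rule frequently_elim1) (use * in blast)
  qed
qed

section \<open>Limits of rescaled Lipschitz light maps\<close>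

lemma Rn_dist_scaled_translates:
  assumes "0 \<le> c"
  shows "Rn_dist m (\<lambda>i. c * (x i - a i)) (\<lambda>i. c * (y i - a i)) = c * Rn_dist m x y"
  using L2_set_right_distrib [OF assms, of "\<lambda>i. x i - y i" "{..<m}"]
  by (simp add: Rn_dist_def algebra_simps)

lemma Rn_dist_triangle: "Rn_dist m x z \<le> Rn_dist m x y + Rn_dist m y z"
  using L2_set_triangle_ineq [of "\<lambda>i. x i - y i" "\<lambda>i. y i - z i" "{..<m}"]
  by (simp add: Rn_dist_def)

lemma Rn_dist_commute: "Rn_dist m x y = Rn_dist m y x"
  by (simp add: Rn_dist_def L2_set_def power2_commute)

text \<open>The limit map is a cluster point of the rescaled maps, translated so that each of them
  vanishes at \<open>z\<close>; without the translation they would be unbounded in general. The lifts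
  \<open>\<sigma> k\<close> are arbitrary functions, so that the statement does not depend on how \<open>Z\<close> arises
  as a limit.\<close>

lemma Lipschitz_light_limit:
  assumes X: "Metric_space X d" and Z: "Metric_space Z dZ"
    and f: "Lipschitz_light X d (Rn m) (Rn_dist m) f"
    and l: "\<And>k. 0 < l k"
    and \<sigma>: "\<And>k w. w \<in> Z \<Longrightarrow> \<sigma> k w \<in> X"
    and lim: "\<And>u v. \<lbrakk>u \<in> Z; v \<in> Z\<rbrakk> \<Longrightarrow> (\<lambda>k. l k * d (\<sigma> k u) (\<sigma> k v)) \<longlonglongrightarrow> dZ u v"
    and "z \<in> Z"
  shows "\<exists>g. Lipschitz_light Z dZ (Rn m) (Rn_dist m) g"
proof -
  interpret X: Metric_space X d by fact
  interpret Z: Metric_space Z dZ by fact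
  obtain C where "0 < C"
    and Lip: "\<forall>x\<in>X. \<forall>y\<in>X. Rn_dist m (f x) (f y) \<le> C * d x y"
    and light: "\<forall>r>0. \<forall>W\<subseteq>Rn m. ediam (Rn_dist m) W \<le> ennreal r \<longrightarrow>
        (\<forall>K \<in> r_components {x\<in>X. f x \<in> W} d r. ediam d K \<le> ennreal (C * r))"
    and fX: "f \<in> X \<rightarrow> Rn m"
    using f unfolding Lipschitz_light_def by (elim conjE exE) (rule that)
  define \<phi> where "\<phi> k w = (\<lambda>i. l k * (f (\<sigma> k w) i - f (\<sigma> k z) i))" for k w
  have \<phi>_dist: "Rn_dist m (\<phi> k u) (\<phi> k v) = l k * Rn_dist m (f (\<sigma> k u)) (f (\<sigma> k v))" for k u v
    unfolding \<phi>_def by (rule Rn_dist_scaled_translates) (use l in \<open>simp add: less_imp_le\<close>)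
  have \<phi>_Lip: "Rn_dist m (\<phi> k u) (\<phi> k v) \<le> C * (l k * d (\<sigma> k u) (\<sigma> k v))"
    if "u \<in> Z" "v \<in> Z" for k u v
    using mult_left_mono [OF Lip [rule_format, OF \<sigma> \<sigma>], of u v "l k" k k] that l [of k]
    by (simp add: \<phi>_dist algebra_simps)
  have "\<exists>B. \<forall>k. \<forall>i<m. \<bar>\<phi> k w i\<bar> \<le> B" if w: "w \<in> Z" for w
  proof -
    obtain B where B: "\<And>k. norm (l k * d (\<sigma> k w) (\<sigma> k z)) \<le> B"
      using convergent_imp_Bseq [OF convergentI [OF lim [OF w \<open>z \<in> Z\<close>]]]
      unfolding Bseq_def by blast
    have "\<bar>\<phi> k w i\<bar> \<le> C * B" if "i < m" for k i
    proof -
      have "\<phi> k z = (\<lambda>i. 0)"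
        by (simp add: \<phi>_def)
      then have "\<bar>\<phi> k w i\<bar> \<le> Rn_dist m (\<phi> k w) (\<phi> k z)"
        using that member_le_L2_set [of "{..<m}" i "\<lambda>i. \<bar>\<phi> k w i\<bar>"]
        by (simp add: Rn_dist_def L2_set_def)
      also have "\<dots> \<le> C * (l k * d (\<sigma> k w) (\<sigma> k z))"
        using \<phi>_Lip \<open>w \<in> Z\<close> \<open>z \<in> Z\<close> .
      also have "\<dots> \<le> C * B"
        using B [of k] \<open>0 < C\<close> by simp
      finally show ?thesis .
    qed
    then show ?thesis by blast
  qed
  then obtain g where g: "\<And>w. g w \<in> Rn m"
    and cluster: "\<And>S e. \<lbrakk>finite S; S \<subseteq> Z; 0 < e\<rbrakk> \<Longrightarrow>
       \<exists>\<^sub>F k in sequentially. \<forall>w\<in>S. Rn_dist m (\<phi> k w) (g w) < e"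
    using Rn_cluster_map [of Z m \<phi>] by blast
  \<comment> \<open>One index \<open>k\<close> serves all distances within a finite set, both in the domain (where
    the distances converge) and in the target (where they only cluster).\<close>
  have approx: "\<exists>k. \<forall>u\<in>S. \<forall>v\<in>S. \<bar>l k * d (\<sigma> k u) (\<sigma> k v) - dZ u v\<bar> < e \<and>
      \<bar>Rn_dist m (\<phi> k u) (\<phi> k v) - Rn_dist m (g u) (g v)\<bar> < 2 * e"
    if S: "finite S" "S \<subseteq> Z" and "0 < e" for S e
  proof -
    have "\<forall>\<^sub>F k in sequentially. \<bar>l k * d (\<sigma> k u) (\<sigma> k v) - dZ u v\<bar> < e"
      if "u \<in> S" "v \<in> S" for u v
      using tendstoD [OF lim \<open>0 < e\<close>] that S by (auto simp: dist_real_def)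
    then have "\<forall>\<^sub>F k in sequentially. \<forall>u\<in>S. \<forall>v\<in>S. \<bar>l k * d (\<sigma> k u) (\<sigma> k v) - dZ u v\<bar> < e"
      using S by (simp add: eventually_ball_finite)
    then obtain k where k: "\<forall>u\<in>S. \<forall>v\<in>S. \<bar>l k * d (\<sigma> k u) (\<sigma> k v) - dZ u v\<bar> < e"
      "\<forall>w\<in>S. Rn_dist m (\<phi> k w) (g w) < e"
      using frequently_ex [OF frequently_eventually_frequently [OF cluster [OF S \<open>0 < e\<close>]]]
      by blast
    have "\<bar>Rn_dist m (\<phi> k u) (\<phi> k v) - Rn_dist m (g u) (g v)\<bar> < 2 * e"
      if "u \<in> S" "v \<in> S" for u v
    proof -
      have "Rn_dist m (\<phi> k u) (g u) < e" "Rn_dist m (\<phi> k v) (g v) < e"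
        using k that by auto
      moreover have "Rn_dist m (\<phi> k u) (\<phi> k v)
          \<le> Rn_dist m (\<phi> k u) (g u) + (Rn_dist m (g u) (g v) + Rn_dist m (\<phi> k v) (g v))"
        using Rn_dist_triangle [of m "\<phi> k u" "\<phi> k v" "g u"]
          Rn_dist_triangle [of m "g u" "\<phi> k v" "g v"] Rn_dist_commute [of m "g v" "\<phi> k v"]
        by linarith
      moreover have "Rn_dist m (g u) (g v)
          \<le> Rn_dist m (\<phi> k u) (g u) + (Rn_dist m (\<phi> k u) (\<phi> k v) + Rn_dist m (\<phi> k v) (g v))"
        using Rn_dist_triangle [of m "g u" "g v" "\<phi> k u"]
          Rn_dist_triangle [of m "\<phi> k u" "g v" "\<phi> k v"] Rn_dist_commute [of m "g u" "\<phi> k u"]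
        by linarith
      ultimately show ?thesis
        by linarith
    qed
    with k show ?thesis by blast
  qed
  have g_Lip: "Rn_dist m (g u) (g v) \<le> C * dZ u v" if uv: "u \<in> Z" "v \<in> Z" for u v
  proof (rule field_le_epsilon)
    fix e :: real assume "0 < e"
    define e' where "e' = e / (C + 2)"
    have "0 < e'" and e: "e = (C + 2) * e'"
      using \<open>0 < e\<close> \<open>0 < C\<close> by (auto simp: e'_def)
    obtain k where k: "\<bar>l k * d (\<sigma> k u) (\<sigma> k v) - dZ u v\<bar> < e'"
      "\<bar>Rn_dist m (\<phi> k u) (\<phi> k v) - Rn_dist m (g u) (g v)\<bar> < 2 * e'"
      using approx [of "{u, v}" e'] uv \<open>0 < e'\<close> by auto
    have "C * (l k * d (\<sigma> k u) (\<sigma> k v)) \<le> C * (dZ u v + e')"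
      using k \<open>0 < C\<close> by (intro mult_left_mono) auto
    then show "Rn_dist m (g u) (g v) \<le> C * dZ u v + e"
      using k \<phi>_Lip [OF uv, of k] by (simp add: e algebra_simps)
  qed
  have g_light: "dZ x y \<le> C * r"
    if "0 < r" and W: "ediam (Rn_dist m) W \<le> ennreal r"
      and xs: "r_path {x\<in>Z. g x \<in> W} dZ r xs" "x \<in> set xs" "y \<in> set xs" for r W xs x y
  proof (rule field_le_epsilon)
    fix e :: real assume "0 < e"
    define e' where "e' = e / (2 * C + 1)"
    have "0 < e'" and e: "e = (2 * C + 1) * e'"
      using \<open>0 < e\<close> \<open>0 < C\<close> by (auto simp: e'_def)
    have xsZ: "set xs \<subseteq> Z" "g ` set xs \<subseteq> W"
      using xs by (auto simp: r_path_def)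
    obtain k where k: "\<And>u v. \<lbrakk>u \<in> set xs; v \<in> set xs\<rbrakk> \<Longrightarrow>
        \<bar>l k * d (\<sigma> k u) (\<sigma> k v) - dZ u v\<bar> < e' \<and>
        \<bar>Rn_dist m (\<phi> k u) (\<phi> k v) - Rn_dist m (g u) (g v)\<bar> < 2 * e'"
      using approx [OF finite_set xsZ(1) \<open>0 < e'\<close>] by blast
    \<comment> \<open>Dividing by \<open>l k\<close> turns the scale of \<open>Z\<close> into the scale of the original metric
      \<open>d\<close>, in which lightness of \<open>f\<close> is given.\<close>
    define s where "s = (r + 2 * e') / l k"
    have "0 < s"
      using \<open>0 < r\<close> \<open>0 < e'\<close> l by (simp add: s_def)
    \<comment> \<open>Lightness is applied to the smallest target set containing the image of the lifted
      chain; the given set \<open>W\<close> need not contain that image.\<close>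
    let ?V = "f ` \<sigma> k ` set xs"
    have "?V \<subseteq> Rn m"
      using fX \<sigma> xsZ by blast
    moreover have "ediam (Rn_dist m) ?V \<le> ennreal s"
    proof -
      have "Rn_dist m (f (\<sigma> k u)) (f (\<sigma> k v)) \<le> s" if "u \<in> set xs" "v \<in> set xs" for u v
      proof -
        have "Rn_dist m (g u) (g v) \<le> r"
          by (rule dist_le_of_ediam_le [OF W]) (use that xsZ \<open>0 < r\<close> in auto)
        then have "l k * Rn_dist m (f (\<sigma> k u)) (f (\<sigma> k v)) \<le> r + 2 * e'"
          using k [OF that] unfolding \<phi>_dist by linarith
        then show ?thesis
          using l [of k] by (simp add: s_def field_simps)
      qed
      then show ?thesis
        unfolding ediam_def by (intro SUP_least ennreal_leI) auto
    qed
    ultimately have "\<forall>K \<in> r_components {x\<in>X. f x \<in> ?V} d s. ediam d K \<le> ennreal (C * s)"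
      using light [rule_format, OF \<open>0 < s\<close>] by blast
    moreover have "r_path {x\<in>X. f x \<in> ?V} d s (map (\<sigma> k) xs)"
    proof -
      have "successively (\<lambda>u v. dZ u v \<le> r) xs"
        using xs by (simp add: r_path_def)
      then have "successively (\<lambda>u v. d (\<sigma> k u) (\<sigma> k v) \<le> s) xs"
      proof (rule successively_mono)
        fix u v assume "u \<in> set xs" "v \<in> set xs" "dZ u v \<le> r"
        then have "l k * d (\<sigma> k u) (\<sigma> k v) \<le> r + 2 * e'"
          using k [of u v] \<open>0 < e'\<close> by linarith
        then show "d (\<sigma> k u) (\<sigma> k v) \<le> s"
          using l [of k] by (simp add: s_def field_simps)
      qed
      then show ?thesis
        using \<sigma> xsZ by (auto simp: r_path_def successively_map)
    qed
    ultimately have "d (\<sigma> k x) (\<sigma> k y) \<le> C * s"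
      by (rule r_path_dist_le) (use xs \<open>0 < C\<close> \<open>0 < s\<close> in auto)
    then have "l k * d (\<sigma> k x) (\<sigma> k y) \<le> C * (r + 2 * e')"
      using l [of k] by (simp add: s_def field_simps)
    then show "dZ x y \<le> C * r + e"
      using conjunct1 [OF k [OF xs(2,3)]] by (simp add: e abs_less_iff algebra_simps)
  qed
  have "Lipschitz_light Z dZ (Rn m) (Rn_dist m) g"
    unfolding Lipschitz_light_def
  proof (intro conjI exI [of _ "2 * C"] ballI allI impI)
    show "g \<in> Z \<rightarrow> Rn m" "0 < 2 * C"
      using g \<open>0 < C\<close> by auto
    show "Rn_dist m (g u) (g v) \<le> 2 * C * dZ u v" if "u \<in> Z" "v \<in> Z" for u v
    proof -
      have "0 \<le> C * dZ u v"
        using \<open>0 < C\<close> by simp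
      then show ?thesis
        using g_Lip [OF that] by linarith
    qed
    show "ediam dZ K \<le> ennreal (2 * C * r)"
      if "0 < r" "ediam (Rn_dist m) W \<le> ennreal r" "K \<in> r_components {x\<in>Z. g x \<in> W} dZ r"
      for r W K
    proof -
      have "ediam dZ K \<le> ennreal (2 * (C * r))"
        using Z _ that(3) g_light [OF that(1,2)] by (rule r_component_ediam_le) auto
      then show ?thesis
        by (simp only: mult.assoc)
    qed
  qed
  then show ?thesis by (rule exI [of _ g])
qed

section \<open>Approximating the points of a limit space\<close>

lemma bi_Lipschitz_snowflake_inj_on:
  assumes "Metric_space X d" "1 \<le> L"
    "bi_Lipschitz L X (\<lambda>x y. d x y powr \<alpha>) (Rn N) (Rn_dist N) e"
  shows "inj_on e X"
proof (rule inj_onI)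
  interpret Metric_space X d by fact
  fix x y assume xy: "x \<in> X" "y \<in> X" "e x = e y"
  then have "d x y powr \<alpha> / L \<le> Rn_dist N (e x) (e y)"
    using assms(3) unfolding bi_Lipschitz_def by blast
  also have "\<dots> = 0"
    using xy by (simp add: Rn_dist_def L2_set_eq_0_iff)
  finally have "d x y powr \<alpha> \<le> 0"
    using \<open>1 \<le> L\<close> by (simp add: divide_le_0_iff)
  then show "x = y"
    using xy by (metis powr_ge_zero order_antisym powr_eq_0_iff zero)
qed

text \<open>The distance from \<open>y\<close> to \<open>F j\<close> tends to 0, and \<open>s j\<close> is chosen to realize it up to
  an error of \<open>1 / (j + 1)\<close>.\<close>

lemma sets_converge_approximants:
  assumes "sets_converge N F F'" "y \<in> F'"
  shows "\<exists>s. (\<forall>j. s j \<in> F j) \<and> limitin (Rn_topology N) s y sequentially"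
proof -
  interpret R: Metric_space "Rn N" "Rn_dist N" by (rule Metric_space_Rn)
  have F: "F j \<noteq> {}" "F j \<subseteq> Rn N" for j
    using assms(1) closedin_subset [of R.mtopology "F j"] by (simp_all add: sets_converge_def)
  have "closedin R.mtopology F'"
    using assms(1) by (simp add: sets_converge_def)
  then have y: "y \<in> Rn N"
    using \<open>y \<in> F'\<close> closedin_subset [of R.mtopology F'] by auto
  have zero: "(\<lambda>i. 0) \<in> Rn N"
    by (simp add: Rn_def topspace_Euclidean_space)
  define R where "R = Rn_dist N (\<lambda>i. 0) y + 1"
  have "0 < R"
    using R.nonneg [of "\<lambda>i. 0" y] unfolding R_def by linarith
  have "y \<in> Rn_ball N (\<lambda>i. 0) R"
    using y zero by (simp add: R_def)
  then have le: "set_dist (Rn_dist N) y (F j)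
      \<le> (SUP y \<in> F' \<inter> Rn_ball N (\<lambda>i. 0) R. set_dist (Rn_dist N) y (F j))" for j
    using \<open>y \<in> F'\<close> by (intro SUP_upper) blast
  have "(\<lambda>j. SUP y \<in> F' \<inter> Rn_ball N (\<lambda>i. 0) R. set_dist (Rn_dist N) y (F j)) \<longlonglongrightarrow> 0"
    using assms(1) \<open>0 < R\<close> by (simp add: sets_converge_def)
  from tendsto_sandwich [OF _ _ tendsto_const this]
  have lim: "(\<lambda>j. set_dist (Rn_dist N) y (F j)) \<longlonglongrightarrow> 0"
    using le by simp
  have "\<exists>s\<in>F j. ennreal (Rn_dist N y s) \<le> set_dist (Rn_dist N) y (F j) + ennreal (1 / Suc j)" for j
  proof (cases "set_dist (Rn_dist N) y (F j) = top")
    case True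
    then show ?thesis using F(1) [of j] by (auto simp: ex_in_conv)
  next
    case False
    then have "set_dist (Rn_dist N) y (F j)
        < set_dist (Rn_dist N) y (F j) + ennreal (1 / Suc j)"
      using ennreal_add_left_cancel_less [of "set_dist (Rn_dist N) y (F j)" 0 "ennreal (1 / Suc j)"]
      by simp
    then show ?thesis
      unfolding set_dist_def INF_less_iff by (auto intro: less_imp_le)
  qed
  then obtain s where s: "\<And>j. s j \<in> F j"
    "\<And>j. ennreal (Rn_dist N y (s j)) \<le> set_dist (Rn_dist N) y (F j) + ennreal (1 / Suc j)"
    by metis
  have "(\<lambda>j. ennreal (1 / Suc j)) \<longlonglongrightarrow> ennreal 0"
    by (intro tendsto_ennrealI LIMSEQ_Suc [OF lim_1_over_n])
  from tendsto_add [OF lim this]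
  have "(\<lambda>j. set_dist (Rn_dist N) y (F j) + ennreal (1 / Suc j)) \<longlonglongrightarrow> 0"
    by simp
  from tendsto_sandwich [OF _ _ tendsto_const this]
  have "(\<lambda>j. ennreal (Rn_dist N y (s j))) \<longlonglongrightarrow> ennreal 0"
    using s(2) by simp
  then have "(\<lambda>j. Rn_dist N y (s j)) \<longlonglongrightarrow> 0"
    by (rule tendsto_ennrealD) (simp_all add: R.nonneg)
  moreover have "(\<lambda>j. Rn_dist N (s j) y) = (\<lambda>j. Rn_dist N y (s j))"
    by (rule ext) (rule Rn_dist_commute)
  moreover have "\<forall>\<^sub>F j in sequentially. s j \<in> Rn N"
    using s(1) F(2) by (intro always_eventually) blast
  ultimately have "limitin R.mtopology s y sequentially"
    unfolding R.limitin_metric_dist_null using y by presburger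
  with s(1) show ?thesis
    by (intro exI conjI allI)
qed

text \<open>The embeddings are injective, so the pulled back metrics evaluated at embedded points are
  the given metrics, and convergence of the metrics as maps becomes convergence of distances
  along the chosen approximants.\<close>

lemma weak_tangent_lifts:
  assumes X: "Metric_space X d" and T: "weak_tangent X d Z dZ z"
  shows "\<exists>l \<sigma>. (\<forall>k. 0 < l k) \<and> (\<forall>k. \<forall>w\<in>Z. \<sigma> k w \<in> X) \<and>
    (\<forall>u\<in>Z. \<forall>v\<in>Z. (\<lambda>k. l k * d (\<sigma> k u) (\<sigma> k v)) \<longlonglongrightarrow> dZ u v)"
proof -
  interpret Metric_space X d by fact
  obtain l x where l: "\<And>k. 0 < l k"
    and conv: "pointed_converges (\<lambda>k. X) (\<lambda>k u v. l k * d u v) x Z dZ z"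
    using T unfolding weak_tangent_def by blast
  from conv obtain \<alpha> N L e e' where "1 \<le> L"
    and e: "\<forall>j. bi_Lipschitz L X (\<lambda>u v. (l j * d u v) powr \<alpha>) (Rn N) (Rn_dist N) (e j) \<and>
              e j (x j) = (\<lambda>i. 0)"
    and e': "bi_Lipschitz L Z (\<lambda>u v. dZ u v powr \<alpha>) (Rn N) (Rn_dist N) e'"
    and sets: "sets_converge N (\<lambda>j. e j ` X) (e' ` Z)"
    and maps: "maps_converge (prod_topology (Rn_topology N) (Rn_topology N)) euclideanreal
          (\<lambda>j. e j ` X \<times> e j ` X) (\<lambda>j. pulled_metric X (\<lambda>u v. l j * d u v) (e j))
          (e' ` Z \<times> e' ` Z) (pulled_metric Z dZ e')"
    unfolding pointed_converges_def by (elim conjE exE) (rule that; assumption)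
  have scaled: "Metric_space X (\<lambda>u v. l j * d u v)" for j
  proof
    show "0 \<le> l j * d u v" for u v
      using l [of j] by simp
    show "l j * d u v = l j * d v u" for u v
      by (simp only: commute [of u v])
    show "l j * d u v = 0 \<longleftrightarrow> u = v" if "u \<in> X" "v \<in> X" for u v
      using l [of j] that by simp
    show "l j * d u w \<le> l j * d u v + l j * d v w" if "u \<in> X" "v \<in> X" "w \<in> X" for u v w
      using mult_left_mono [OF triangle [OF that], of "l j"] l [of j]
      by (simp add: distrib_left)
  qed
  have inj: "inj_on (e j) X" for j
    by (rule bi_Lipschitz_snowflake_inj_on
        [OF scaled \<open>1 \<le> L\<close> conjunct1 [OF spec [OF e]]])
  have "Metric_space Z dZ"
    using T by (simp add: weak_tangent_def)
  then have inj': "inj_on e' Z"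
    using \<open>1 \<le> L\<close> e' by (rule bi_Lipschitz_snowflake_inj_on)
  have "\<exists>s. (\<forall>j. s j \<in> X) \<and> limitin (Rn_topology N) (\<lambda>j. e j (s j)) (e' w) sequentially"
    if w: "w \<in> Z" for w
  proof -
    obtain t where t: "\<forall>j. t j \<in> e j ` X" "limitin (Rn_topology N) t (e' w) sequentially"
      using sets_converge_approximants [OF sets imageI [OF w]] by (elim exE conjE) (rule that)
    have "e j (inv_into X (e j) (t j)) = t j" "inv_into X (e j) (t j) \<in> X" for j
      using t(1) by (auto intro: f_inv_into_f inv_into_into)
    with t(2) show ?thesis
      by (intro exI [of _ "\<lambda>j. inv_into X (e j) (t j)"]) simp
  qed
  then obtain \<tau> where \<tau>: "\<And>w j. w \<in> Z \<Longrightarrow> \<tau> w j \<in> X"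
    "\<And>w. w \<in> Z \<Longrightarrow> limitin (Rn_topology N) (\<lambda>j. e j (\<tau> w j)) (e' w) sequentially"
    by metis
  have lim: "(\<lambda>k. l k * d (\<tau> u k) (\<tau> v k)) \<longlonglongrightarrow> dZ u v" if uv: "u \<in> Z" "v \<in> Z" for u v
  proof -
    have "limitin (prod_topology (Rn_topology N) (Rn_topology N))
        (\<lambda>k. (e k (\<tau> u k), e k (\<tau> v k))) (e' u, e' v) sequentially"
      using \<tau> uv by (simp add: limitin_pairwise o_def)
    moreover have "\<forall>k. (e k (\<tau> u k), e k (\<tau> v k)) \<in> e k ` X \<times> e k ` X"
      "(e' u, e' v) \<in> e' ` Z \<times> e' ` Z"
      using \<tau>(1) uv by simp_all
    ultimately have "limitin euclideanreal
        (\<lambda>k. pulled_metric X (\<lambda>u v. l k * d u v) (e k) (e k (\<tau> u k), e k (\<tau> v k)))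
        (pulled_metric Z dZ e' (e' u, e' v)) sequentially"
      using maps [unfolded maps_converge_def, rule_format,
          of "\<lambda>k. (e k (\<tau> u k), e k (\<tau> v k))" "(e' u, e' v)"]
      by simp
    then show ?thesis
      using \<tau> uv by (simp add: pulled_metric_def inv_into_f_f inj inj')
  qed
  show ?thesis
    by (intro exI [of _ l] exI [of _ "\<lambda>k w. \<tau> w k"] conjI allI ballI)
      (simp_all add: l \<tau>(1) lim)
qed

section \<open>Lipschitz dimension of weak tangents\<close>

lemma Lipschitz_dim_le_iff:
  "Lipschitz_dim X d \<le> enat n \<longleftrightarrow>
     (\<exists>m\<le>n. \<exists>f. Lipschitz_light X d (Rn m) (Rn_dist m) f)"
proof
  let ?A = "{enat n |n. \<exists>f. Lipschitz_light X d (Rn n) (Rn_dist n) f}"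
  assume le: "Lipschitz_dim X d \<le> enat n"
  then have "?A \<noteq> {}"
    by (auto simp: Lipschitz_dim_def Inf_enat_def split: if_splits)
  then have "Inf ?A = (LEAST a. a \<in> ?A)" "\<exists>a. a \<in> ?A"
    unfolding Inf_enat_def by auto
  then have "Inf ?A \<in> ?A"
    using LeastI_ex [of "\<lambda>a. a \<in> ?A"] by simp
  then obtain m where "Lipschitz_dim X d = enat m" "\<exists>f. Lipschitz_light X d (Rn m) (Rn_dist m) f"
    unfolding Lipschitz_dim_def by blast
  with le show "\<exists>m\<le>n. \<exists>f. Lipschitz_light X d (Rn m) (Rn_dist m) f"
    by auto
next
  assume "\<exists>m\<le>n. \<exists>f. Lipschitz_light X d (Rn m) (Rn_dist m) f"
  then obtain m where "m \<le> n" "\<exists>f. Lipschitz_light X d (Rn m) (Rn_dist m) f"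
    by blast
  then show "Lipschitz_dim X d \<le> enat n"
    unfolding Lipschitz_dim_def by (intro Inf_lower2 [of "enat m"]) auto
qed

theorem corollary4p17:
  fixes X :: "'a set" and d :: "'a \<Rightarrow> 'a \<Rightarrow> real"
    and Z :: "'b set" and dZ :: "'b \<Rightarrow> 'b \<Rightarrow> real" and z :: 'b
    and n :: nat
  assumes "Metric_space X d"
    and "doubling X d"
    and "Lipschitz_dim X d \<le> enat n"
    and "weak_tangent X d Z dZ z"
  shows "Lipschitz_dim Z dZ \<le> enat n"
proof -
  obtain m f where "m \<le> n" and f: "Lipschitz_light X d (Rn m) (Rn_dist m) f"
    using assms(3) unfolding Lipschitz_dim_le_iff by blast
  have Z: "Metric_space Z dZ" "z \<in> Z"
    using assms(4) by (auto simp: weak_tangent_def)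
  obtain l \<sigma> where "\<forall>k. 0 < l k" "\<forall>k. \<forall>w\<in>Z. \<sigma> k w \<in> X"
    "\<forall>u\<in>Z. \<forall>v\<in>Z. (\<lambda>k. l k * d (\<sigma> k u) (\<sigma> k v)) \<longlonglongrightarrow> dZ u v"
    using weak_tangent_lifts [OF assms(1,4)] by (elim exE conjE) (rule that)
  then have "\<exists>g. Lipschitz_light Z dZ (Rn m) (Rn_dist m) g"
    by (intro Lipschitz_light_limit [OF assms(1) Z(1) f _ _ _ Z(2), of l \<sigma>]) simp_all
  with \<open>m \<le> n\<close> show ?thesis
    unfolding Lipschitz_dim_le_iff by blast
qed

end
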